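(* For all names $P,Q$: if $\eta\,Q\,\mathit{Region}$ and $\neg(Q\equiv\mathit{Gspace})$, then $\eta\,P\,(\mathit{closureG}\,Q)\leftrightarrow\eta\,P\,((\mathit{InteriorG}\,Q)\cup(\partial\,Q))$.
   Context: Setting: a Coq formalization (classical logic) of Leśniewski's Ontology and Mereology extended with Tarski's geometry of solids. Names form a type $N$ with a primitive relation $\eta:N\to N\to\mathrm{Prop}$ satisfying Leśniewski's ontological axiom $\eta\,A\,b \leftrightarrow ((\exists C,\eta\,C\,A)\wedge(\forall C\,D,\eta\,C\,A\wedge\eta\,D\,A\to\eta\,C\,D)\wedge(\forall C,\eta\,C\,A\to\eta\,C\,b))$; $A$ is an individual iff $\eta\,A\,A$; $\eta\,P\,(a\cup b)\leftrightarrow(\eta\,P\,a\vee\eta\,P\,b)$, $\eta\,P\,(a\cap b)\leftrightarrow(\eta\,P\,a\wedge\eta\,P\,b)$; $a\subseteq b$ means $\forall P,\eta\,P\,a\to\eta\,P\,b$; $P\equiv Q$ means $\eta\,P\,Q\wedge\eta\,Q\,P$. Mereology: $pt:N\to N$ ($\eta\,B\,(pt\,A)$: $B$ is a part of $A$) satisfying Leśniewski's mereology axioms (part-of a partial order on individuals; every non-empty name has a unique m-class). M-class: $\eta\,A\,(klass\,a)$ iff $\eta\,A\,A$, $\forall B,\eta\,B\,a\to\eta\,B\,(pt\,A)$, and $\forall B,\eta\,B\,(pt\,A)\to\exists C\,D,\eta\,C\,a\wedge\eta\,D\,(pt\,C)\wedge\eta\,D\,(pt\,B)$. $\eta\,P\,(ext\,Q)$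 iff $P,Q$ are individuals with no common part ("exterior"). Geometry: $\mathit{balls}$ is a primitive name (there exists at least one ball); $\eta\,P\,\mathit{Gspace}$ iff $\eta\,P\,(klass\,\mathit{balls})$. Tarski's definitions for balls: $A$ is externally tangent to $B$ iff $A$ is exterior to $B$ and for any balls $X,Y$ both having $A$ as part and both exterior to $B$, one of $X,Y$ is part of the other; $A$ is internally tangent to $B$ iff $A$ is a proper part of $B$ and for any balls $X,Y$ both having $A$ as a part and both parts of $B$, one of $X,Y$ is part of the other; $A,B$ are externally diametrical w.r.t. $C$ iff both are externally tangent to $C$ and for any balls $X,Y$ exterior to $C$ with $A$ part of $X$ and $B$ part of $Y$, $X$ is exterior to $Y$; $A,B$ are internally diametrical w.r.t. $C$ iff both are internally tangent to $C$ and for any balls $X,Y$ externally tangent to $C$ with $A$ exterior to $X$ and $B$ exterior to $Y$, $X$ is exterior to $Y$; $A$ is concentric with $B$ iff $A=B$, or $A$ is a proper part of $B$ and any balls $X,Y$ externally diametrical w.r.t. $A$ and internally tangent to $B$ are internally diametrical w.r.t. $B$, or the same holds with $A,B$ interchanged. $\eta\,P\,(\mathit{Concent}\,Q)$ iff $P,Q$ are balls and $P$ is concentric with $Q$. Point: $\eta\,P\,(\mathit{Point}\,Q)$ iff $\eta\,P\,\mathit{balls}\wedge\eta\,Q\,\mathit{balls}\wedge\eta\,P\,(\mathit{Concent}\,Q)$. Region: $\eta\,P\,\mathit{Region}$ iff $\eta\,P\,P$ and $\exists b,\ b\subseteq\mathit{balls}\wedge\eta\,P\,(klass\,b)$. Saturated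 interior point: $\eta\,P\,(\mathit{sat\_InteriorPoint}\,Q)$ iff $\eta\,Q\,\mathit{Region}$ and $\exists P',\ \eta\,P\,(\mathit{Point}\,P')\wedge\eta\,P'\,(pt\,Q)\wedge(\eta\,P'\,(pt\,P)\to P\equiv P')$. $\eta\,P\,(\mathit{InteriorG}\,Q)$ iff $\eta\,P\,(klass\,(\mathit{sat\_InteriorPoint}\,Q))$. Boundary: $\eta\,P\,(\partial\,Q)$ iff $\eta\,Q\,\mathit{Region}$, $\eta\,P\,\mathit{balls}$, and $\forall Y,\ (\eta\,Y\,\mathit{balls}\wedge\eta\,P\,(\mathit{Point}\,Y))\to(\neg\eta\,Y\,(pt\,Q)\wedge\neg\eta\,Y\,(ext\,Q))$. Complement in $\mathit{Gspace}$: $\eta\,P\,(\mathit{complG}\,Q)$ iff $\eta\,Q\,(pt\,\mathit{Gspace})$ and $\eta\,P\,(klass\,((pt\,\mathit{Gspace})\cap(ext\,Q)))$. Topological complement: $\eta\,P\,(\mathit{Tcompl}\,Q)$ iff $\eta\,P\,((\mathit{complG}\,Q)\cup(\partial\,Q))$. Closure: $\eta\,P\,(\mathit{closureG}\,Q)$ iff $\eta\,P\,\mathit{Region}\wedge\eta\,Q\,\mathit{Region}\wedge\eta\,P\,(\mathit{Tcompl}\,(\mathit{InteriorG}\,(\mathit{complG}\,Q)))$.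
   Formalization: The formal theorem adds Tarski's postulate that every part of a ball has a ball as a part; from the listed axioms alone the claim fails (individuals: non-empty subsets of {0,1,2}; balls {0,1}, {1,2}; Q={0,1}: complG Q={2} is no Region, so closureG Q is empty while InteriorG Q is not). *)

theory Defs
  imports Main
begin

text \<open>
  Names are the elements of an arbitrary type. The name-forming operations are parameters of the
  locales, each governed by its Lesniewskian definition, that is, by an equivalence for
  \<open>\<eta> P (f \<dots>)\<close>. Such an equivalence fixes the values of an operation only up to coextensiveness
  of names; no extensionality principle for names is assumed.
\<close>

locale ontology =
  fixes \<eta> :: "'n \<Rightarrow> 'n \<Rightarrow> bool"
    and cup :: "'n \<Rightarrow> 'n \<Rightarrow> 'n"
    and cap :: "'n \<Rightarrow> 'n \<Rightarrow> 'n"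
  assumes ontological_axiom:
      "\<eta> A b \<longleftrightarrow> (\<exists>C. \<eta> C A) \<and> (\<forall>C D. \<eta> C A \<and> \<eta> D A \<longrightarrow> \<eta> C D) \<and> (\<forall>C. \<eta> C A \<longrightarrow> \<eta> C b)"
    and cup_iff: "\<eta> P (cup a b) \<longleftrightarrow> \<eta> P a \<or> \<eta> P b"
    and cap_iff: "\<eta> P (cap a b) \<longleftrightarrow> \<eta> P a \<and> \<eta> P b"
begin

definition sub_name :: "'n \<Rightarrow> 'n \<Rightarrow> bool" where
  "sub_name a b \<longleftrightarrow> (\<forall>P. \<eta> P a \<longrightarrow> \<eta> P b)"

definition same :: "'n \<Rightarrow> 'n \<Rightarrow> bool" where
  "same P Q \<longleftrightarrow> \<eta> P Q \<and> \<eta> Q P"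

end

locale mereology = ontology \<eta> cup cap
  for \<eta> :: "'n \<Rightarrow> 'n \<Rightarrow> bool" and cup cap +
  fixes pt :: "'n \<Rightarrow> 'n"
    and klass :: "'n \<Rightarrow> 'n"
    and ext :: "'n \<Rightarrow> 'n"
  assumes pt_individual: "\<eta> A (pt B) \<Longrightarrow> \<eta> B B"
    and pt_refl: "\<eta> A A \<Longrightarrow> \<eta> A (pt A)"
    and pt_antisym: "\<eta> A (pt B) \<Longrightarrow> \<eta> B (pt A) \<Longrightarrow> same A B"
    and pt_trans: "\<eta> A (pt B) \<Longrightarrow> \<eta> B (pt C) \<Longrightarrow> \<eta> A (pt C)"
    and klass_iff:
      "\<eta> A (klass a) \<longleftrightarrow> \<eta> A A \<and> (\<forall>B. \<eta> B a \<longrightarrow> \<eta> B (pt A)) \<and>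
         (\<forall>B. \<eta> B (pt A) \<longrightarrow> (\<exists>C D. \<eta> C a \<and> \<eta> D (pt C) \<and> \<eta> D (pt B)))"
    and klass_unique: "\<eta> A (klass a) \<Longrightarrow> \<eta> B (klass a) \<Longrightarrow> same A B"
    and klass_exists: "\<eta> A a \<Longrightarrow> \<exists>B. \<eta> B (klass a)"
    and ext_iff: "\<eta> P (ext Q) \<longleftrightarrow> \<eta> P P \<and> \<eta> Q Q \<and> \<not> (\<exists>R. \<eta> R (pt P) \<and> \<eta> R (pt Q))"
begin

definition proper_part :: "'n \<Rightarrow> 'n \<Rightarrow> bool" where
  "proper_part A B \<longleftrightarrow> \<eta> A (pt B) \<and> \<not> same A B"

end

locale ball_mereology = mereology \<eta> cup cap pt klass ext
  for \<eta> :: "'n \<Rightarrow> 'n \<Rightarrow> bool" and cup cap pt klass ext +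
  fixes balls :: 'n
  assumes ball_exists: "\<exists>B. \<eta> B balls"
begin

definition ext_tangent :: "'n \<Rightarrow> 'n \<Rightarrow> bool" where
  "ext_tangent A B \<longleftrightarrow> \<eta> A balls \<and> \<eta> B balls \<and> \<eta> A (ext B) \<and>
     (\<forall>X Y. \<eta> X balls \<and> \<eta> Y balls \<and> \<eta> A (pt X) \<and> \<eta> A (pt Y) \<and> \<eta> X (ext B) \<and> \<eta> Y (ext B)
        \<longrightarrow> \<eta> X (pt Y) \<or> \<eta> Y (pt X))"

definition int_tangent :: "'n \<Rightarrow> 'n \<Rightarrow> bool" where
  "int_tangent A B \<longleftrightarrow> \<eta> A balls \<and> \<eta> B balls \<and> proper_part A B \<and>
     (\<forall>X Y. \<eta> X balls \<and> \<eta> Y balls \<and> \<eta> A (pt X) \<and> \<eta> A (pt Y) \<and> \<eta> X (pt B) \<and> \<eta> Y (pt B)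
        \<longrightarrow> \<eta> X (pt Y) \<or> \<eta> Y (pt X))"

definition ext_diametrical :: "'n \<Rightarrow> 'n \<Rightarrow> 'n \<Rightarrow> bool" where
  "ext_diametrical A B C \<longleftrightarrow> ext_tangent A C \<and> ext_tangent B C \<and>
     (\<forall>X Y. \<eta> X balls \<and> \<eta> Y balls \<and> \<eta> X (ext C) \<and> \<eta> Y (ext C) \<and> \<eta> A (pt X) \<and> \<eta> B (pt Y)
        \<longrightarrow> \<eta> X (ext Y))"

definition int_diametrical :: "'n \<Rightarrow> 'n \<Rightarrow> 'n \<Rightarrow> bool" where
  "int_diametrical A B C \<longleftrightarrow> int_tangent A C \<and> int_tangent B C \<and>
     (\<forall>X Y. \<eta> X balls \<and> \<eta> Y balls \<and> ext_tangent X C \<and> ext_tangent Y C \<and>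
        \<eta> A (ext X) \<and> \<eta> B (ext Y) \<longrightarrow> \<eta> X (ext Y))"

definition inner_concentric :: "'n \<Rightarrow> 'n \<Rightarrow> bool" where
  "inner_concentric A B \<longleftrightarrow> proper_part A B \<and>
     (\<forall>X Y. \<eta> X balls \<and> \<eta> Y balls \<and> ext_diametrical X Y A \<and> int_tangent X B \<and> int_tangent Y B
        \<longrightarrow> int_diametrical X Y B)"

text \<open>The equality of balls in Tarski's definition is identity of individuals, not HOL equality of
  names.\<close>

definition concentric :: "'n \<Rightarrow> 'n \<Rightarrow> bool" where
  "concentric A B \<longleftrightarrow> same A B \<or> inner_concentric A B \<or> inner_concentric B A"

end

locale solid_geometry = ball_mereology \<eta> cup cap pt klass ext balls
  for \<eta> :: "'n \<Rightarrow> 'n \<Rightarrow> bool" and cup cap pt klass ext balls +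
  fixes Gspace :: 'n
    and Concent :: "'n \<Rightarrow> 'n"
    and Point :: "'n \<Rightarrow> 'n"
    and Region :: 'n
    and sat_InteriorPoint :: "'n \<Rightarrow> 'n"
    and InteriorG :: "'n \<Rightarrow> 'n"
    and boundary :: "'n \<Rightarrow> 'n"
    and complG :: "'n \<Rightarrow> 'n"
    and Tcompl :: "'n \<Rightarrow> 'n"
    and closureG :: "'n \<Rightarrow> 'n"
  assumes Gspace_iff: "\<eta> P Gspace \<longleftrightarrow> \<eta> P (klass balls)"
    and Concent_iff: "\<eta> P (Concent Q) \<longleftrightarrow> \<eta> P balls \<and> \<eta> Q balls \<and> concentric P Q"
    and Point_iff: "\<eta> P (Point Q) \<longleftrightarrow> \<eta> P balls \<and> \<eta> Q balls \<and> \<eta> P (Concent Q)"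
    and Region_iff: "\<eta> P Region \<longleftrightarrow> \<eta> P P \<and> (\<exists>b. sub_name b balls \<and> \<eta> P (klass b))"
    and sat_InteriorPoint_iff:
      "\<eta> P (sat_InteriorPoint Q) \<longleftrightarrow> \<eta> Q Region \<and>
         (\<exists>P'. \<eta> P (Point P') \<and> \<eta> P' (pt Q) \<and> (\<eta> P' (pt P) \<longrightarrow> same P P'))"
    and InteriorG_iff: "\<eta> P (InteriorG Q) \<longleftrightarrow> \<eta> P (klass (sat_InteriorPoint Q))"
    and boundary_iff:
      "\<eta> P (boundary Q) \<longleftrightarrow> \<eta> Q Region \<and> \<eta> P balls \<and>
         (\<forall>Y. \<eta> Y balls \<and> \<eta> P (Point Y) \<longrightarrow> \<not> \<eta> Y (pt Q) \<and> \<not> \<eta> Y (ext Q))"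
    and complG_iff:
      "\<eta> P (complG Q) \<longleftrightarrow> \<eta> Q (pt Gspace) \<and> \<eta> P (klass (cap (pt Gspace) (ext Q)))"
    and Tcompl_iff: "\<eta> P (Tcompl Q) \<longleftrightarrow> \<eta> P (cup (complG Q) (boundary Q))"
    and closureG_iff:
      "\<eta> P (closureG Q) \<longleftrightarrow>
         \<eta> P Region \<and> \<eta> Q Region \<and> \<eta> P (Tcompl (InteriorG (complG Q)))"

text \<open>
  The additional assumption is the form 4'' that Tarski gives for the last postulate of his geometry
  of solids: every part of a ball has a ball among its parts. Over mereology it is equivalent to his
  form 4': every part of a solid (here: of a region) is a solid. Without it the complement
  of a region need not be a region, and then \<open>closureG\<close> of that region is empty.
\<close>

locale tarski_solid_geometry =
  solid_geometry \<eta> cup cap pt klass ext balls Gspace Concent Point Region sat_InteriorPoint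
    InteriorG boundary complG Tcompl closureG
  for \<eta> :: "'n \<Rightarrow> 'n \<Rightarrow> bool" and cup cap pt klass ext balls Gspace Concent Point Region
    sat_InteriorPoint InteriorG boundary complG Tcompl closureG +
  assumes part_of_ball: "\<eta> A balls \<Longrightarrow> \<eta> B (pt A) \<Longrightarrow> \<exists>C. \<eta> C balls \<and> \<eta> C (pt B)"

end

theory Submission
  imports Defs
begin

text \<open>
  A ball is a saturated interior point of a region exactly when it is part of it, so a region is the
  same individual as its interior. By Tarski's postulate every part of space contains a ball, hence
  the complement of a region other than space is again a region. Complementation is an involution
  that exchanges ``part of'' with ``exterior to'', so a region and its complement have the same
  boundary. Therefore the topological complement of the interior of the complement of \<open>Q\<close> consists
  of \<open>Q\<close> together with its boundary.
\<close>

section \<open>Individuals and coextensive names\<close>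

context ontology
begin

lemma eta_individual: "\<eta> A b \<Longrightarrow> \<eta> A A"
  using ontological_axiom[of A b] ontological_axiom[of A A] by blast

lemma eta_trans: "\<eta> A B \<Longrightarrow> \<eta> B c \<Longrightarrow> \<eta> A c"
  using ontological_axiom[of B c] by blast

text \<open>Coextensive names need not be equal, so substitution in subject position has to be
  proved. The ontological axiom depends on the subject only through what falls under it.\<close>

lemma individual_cong:
  assumes "\<And>P. \<eta> P A \<longleftrightarrow> \<eta> P B"
  shows "\<eta> A c \<longleftrightarrow> \<eta> B c"
  using assms ontological_axiom[of A c] ontological_axiom[of B c] by simp

end

section \<open>Parts, classes and supplementation\<close>

context mereology
begin

text \<open>A name that has a part is an individual, and coextensive individuals are parts of each
  other; transitivity does the rest.\<close>

lemma pt_cong: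
  assumes "\<And>P. \<eta> P A \<longleftrightarrow> \<eta> P B"
  shows "\<eta> P (pt A) \<longleftrightarrow> \<eta> P (pt B)"
proof -
  have "\<eta> P (pt B)" if "\<eta> P (pt A)" and AB: "\<And>P. \<eta> P A \<longleftrightarrow> \<eta> P B" for A B
  proof -
    have "\<eta> A A" using that pt_individual by blast
    then have "\<eta> A B" "\<eta> B B" using individual_cong[OF AB] AB by blast+
    then have "\<eta> A (pt B)" using pt_refl eta_trans by blast
    then show ?thesis using that pt_trans by blast
  qed
  then show ?thesis using assms by metis
qed

lemma ext_cong:
  assumes "\<And>P. \<eta> P A \<longleftrightarrow> \<eta> P B"
  shows "\<eta> P (ext A) \<longleftrightarrow> \<eta> P (ext B)"
  using assms pt_cong[OF assms] individual_cong[OF assms] unfolding ext_iff by metis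

lemma klass_cong:
  assumes "\<And>P. \<eta> P a \<longleftrightarrow> \<eta> P b"
  shows "\<eta> A (klass a) \<longleftrightarrow> \<eta> A (klass b)"
  unfolding klass_iff using assms by simp

text \<open>Uniqueness of classes lets the individual \<open>K\<close> stand in for the name
  \<open>klass a\<close>.\<close>

lemma eta_klass_iff:
  assumes "\<eta> K (klass a)"
  shows "\<eta> P (klass a) \<longleftrightarrow> \<eta> P K"
  using assms klass_unique eta_trans unfolding same_def by blast

lemma same_part: "same A B \<Longrightarrow> \<eta> A (pt B)"
  unfolding same_def using eta_trans pt_refl eta_individual by blast

lemma klass_of_individual:
  assumes "\<eta> B B"
  shows "\<eta> B (klass B)"
proof -
  have "\<eta> C (pt B)" if "\<eta> C B" for C
    using that assms eta_trans pt_refl by blast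
  then show ?thesis
    unfolding klass_iff using assms eta_individual pt_refl by blast
qed

text \<open>Strong supplementation: the class of \<open>A\<close> and \<open>B\<close> together is already the class of \<open>B\<close>.\<close>

lemma part_if_parts_overlap:
  assumes A: "\<eta> A A" and B: "\<eta> B B"
    and overlap: "\<And>D. \<eta> D (pt A) \<Longrightarrow> \<exists>E. \<eta> E (pt D) \<and> \<eta> E (pt B)"
  shows "\<eta> A (pt B)"
proof -
  obtain K where K: "\<eta> K (klass (cup A B))"
    using klass_exists[of A "cup A B"] A cup_iff by blast
  have KK: "\<eta> K K" and AK: "\<eta> A (pt K)" and BK: "\<eta> B (pt K)"
    using K A B cup_iff unfolding klass_iff by blast+
  have "\<exists>C E. \<eta> C B \<and> \<eta> E (pt C) \<and> \<eta> E (pt D)" if D: "\<eta> D (pt K)" for D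
  proof -
    obtain C E where CE: "\<eta> C (cup A B)" "\<eta> E (pt C)" "\<eta> E (pt D)"
      using K D unfolding klass_iff by blast
    have "\<eta> E (pt A) \<or> \<eta> E (pt B)"
      using CE A B eta_trans pt_refl pt_trans unfolding cup_iff by metis
    then show ?thesis using overlap CE B pt_trans by blast
  qed
  moreover have "\<eta> C (pt K)" if "\<eta> C B" for C
    using that BK eta_trans by blast
  ultimately have "\<eta> K (klass B)" using KK unfolding klass_iff by blast
  then have "same K B" using klass_of_individual[OF B] klass_unique by blast
  then show ?thesis using AK same_part pt_trans by blast
qed

lemma exterior_part_exists:
  assumes "\<eta> A A" "\<eta> B B" "\<not> \<eta> A (pt B)"
  obtains D where "\<eta> D (pt A)" "\<eta> D (ext B)"
  using part_if_parts_overlap[of A B] assms eta_individual unfolding ext_iff by blast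

text \<open>Each part of \<open>K\<close> overlaps something under \<open>a\<close>, hence overlaps
  \<open>B\<close>, and strong supplementation applies.\<close>

lemma klass_least:
  assumes K: "\<eta> K (klass a)" and B: "\<eta> B B"
    and bound: "\<And>C. \<eta> C a \<Longrightarrow> \<eta> C (pt B)"
  shows "\<eta> K (pt B)"
proof (rule part_if_parts_overlap[OF _ B])
  show "\<eta> K K" using K eta_individual by blast
next
  fix D assume "\<eta> D (pt K)"
  then show "\<exists>E. \<eta> E (pt D) \<and> \<eta> E (pt B)"
    using K bound pt_trans unfolding klass_iff by blast
qed

section \<open>The complement of an individual relative to a whole\<close>

context
  fixes G Q R
  assumes QG: "\<eta> Q (pt G)"
    and R: "\<eta> R (klass (cap (pt G) (ext Q)))"
begin

lemma complement_part: "\<eta> R (pt G)"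
  using klass_least[OF R] QG pt_individual cap_iff by blast

text \<open>A common part of \<open>Q\<close> and \<open>R\<close> would overlap something exterior
  to \<open>Q\<close>, although it lies in \<open>Q\<close>.\<close>

lemma part_complement_iff:
  assumes Y: "\<eta> Y (pt G)"
  shows "\<eta> Y (pt R) \<longleftrightarrow> \<eta> Y (ext Q)"
proof
  assume YR: "\<eta> Y (pt R)"
  have False if D: "\<eta> D (pt Y)" "\<eta> D (pt Q)" for D
  proof -
    have "\<eta> D (pt R)" using D YR pt_trans by blast
    then obtain C E where "\<eta> C (ext Q)" "\<eta> E (pt C)" "\<eta> E (pt D)"
      using R cap_iff unfolding klass_iff by blast
    then show False using D pt_trans unfolding ext_iff by blast
  qed
  then show "\<eta> Y (ext Q)"
    unfolding ext_iff using Y QG eta_individual by blast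
next
  assume "\<eta> Y (ext Q)"
  then show "\<eta> Y (pt R)" using R Y cap_iff unfolding klass_iff by blast
qed

text \<open>If \<open>Y\<close> were not inside \<open>Q\<close>, strong supplementation would give
  a part of \<open>Y\<close> exterior to \<open>Q\<close>, hence a part of \<open>R\<close>.\<close>

lemma exterior_complement_iff:
  assumes Y: "\<eta> Y (pt G)"
  shows "\<eta> Y (ext R) \<longleftrightarrow> \<eta> Y (pt Q)"
proof
  assume YR: "\<eta> Y (ext R)"
  show "\<eta> Y (pt Q)"
  proof (rule ccontr)
    assume "\<not> \<eta> Y (pt Q)"
    then obtain D where D: "\<eta> D (pt Y)" "\<eta> D (ext Q)"
      using exterior_part_exists Y QG eta_individual by metis
    then have "\<eta> D (pt R)" using part_complement_iff Y pt_trans by blast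
    then show False using YR D unfolding ext_iff by blast
  qed
next
  assume YQ: "\<eta> Y (pt Q)"
  have False if D: "\<eta> D (pt Y)" "\<eta> D (pt R)" for D
  proof -
    have "\<eta> D (ext Q)" using D part_complement_iff Y pt_trans by blast
    moreover have "\<eta> D (pt D)" "\<eta> D (pt Q)"
      using D YQ pt_refl eta_individual pt_trans by blast+
    ultimately show False unfolding ext_iff by blast
  qed
  then show "\<eta> Y (ext R)"
    unfolding ext_iff using Y complement_part eta_individual by blast
qed

text \<open>The parts of \<open>G\<close> exterior to \<open>R\<close> are exactly the parts of
  \<open>Q\<close>, and an individual is the class of its own parts.\<close>

lemma complement_complement: "\<eta> Q (klass (cap (pt G) (ext R)))"
proof -
  have "\<eta> B (pt Q)" if "\<eta> B (cap (pt G) (ext R))" for B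
    using that exterior_complement_iff cap_iff by blast
  moreover have "\<eta> B (cap (pt G) (ext R))" "\<eta> B (pt B)" if "\<eta> B (pt Q)" for B
    using that exterior_complement_iff cap_iff QG pt_trans pt_refl eta_individual by blast+
  ultimately show ?thesis
    unfolding klass_iff using QG eta_individual by blast
qed

end

end

section \<open>Space, regions and interiors\<close>

context solid_geometry
begin

text \<open>Existence and uniqueness of the class of balls are what the ontological axiom demands of
  an individual.\<close>

lemma Gspace_individual: "\<eta> Gspace Gspace"
proof -
  obtain K where "\<eta> K (klass balls)" using ball_exists klass_exists by blast
  then show ?thesis
    using ontological_axiom[of Gspace Gspace] Gspace_iff klass_unique unfolding same_def by blast
qed

lemma Gspace_klass: "\<eta> Gspace (klass balls)"
  using Gspace_individual Gspace_iff by blast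

lemma ball_part_Gspace: "\<eta> B balls \<Longrightarrow> \<eta> B (pt Gspace)"
  using Gspace_klass unfolding klass_iff by blast

lemma ball_Region:
  assumes "\<eta> B balls"
  shows "\<eta> B Region"
proof -
  have BB: "\<eta> B B" using assms eta_individual by blast
  \<comment> \<open>The singular name \<open>B\<close> itself serves as the generating name of
    balls.\<close>
  have "sub_name B balls" unfolding sub_name_def using assms eta_trans by blast
  then show ?thesis unfolding Region_iff using BB klass_of_individual by blast
qed

lemma Region_part_Gspace: "\<eta> Q Region \<Longrightarrow> \<eta> Q (pt Gspace)"
  using klass_least Gspace_individual ball_part_Gspace unfolding Region_iff sub_name_def by blast

text \<open>Enlarging the generating name to all balls inside \<open>Q\<close> does not change its
  class, which makes the choice of balls canonical.\<close>

lemma Region_klass_balls: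
  assumes "\<eta> Q Region"
  shows "\<eta> Q (klass (cap balls (pt Q)))"
proof -
  obtain b where b: "sub_name b balls" "\<eta> Q (klass b)" and QQ: "\<eta> Q Q"
    using assms Region_iff by blast
  then have "\<eta> C (cap balls (pt Q))" if "\<eta> C b" for C
    using that unfolding klass_iff sub_name_def cap_iff by blast
  then show ?thesis using b QQ cap_iff unfolding klass_iff by blast
qed

text \<open>The last conjunct of \<open>sat_InteriorPoint_iff\<close> excludes the case that \<open>P'\<close> is a proper part
  of the concentric ball \<open>P\<close>.\<close>

lemma sat_InteriorPoint_eq_ball_part:
  assumes "\<eta> Q Region"
  shows "\<eta> P (sat_InteriorPoint Q) \<longleftrightarrow> \<eta> P (cap balls (pt Q))"
proof
  assume "\<eta> P (sat_InteriorPoint Q)"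
  then obtain P' where P': "\<eta> P balls" "concentric P P'" "\<eta> P' (pt Q)"
      "\<eta> P' (pt P) \<longrightarrow> same P P'"
    unfolding sat_InteriorPoint_iff Point_iff Concent_iff by blast
  then have "\<eta> P (pt P')"
    using same_part unfolding concentric_def inner_concentric_def proper_part_def by blast
  then show "\<eta> P (cap balls (pt Q))" using P' pt_trans cap_iff by blast
next
  assume P: "\<eta> P (cap balls (pt Q))"
  then have "same P P" using eta_individual unfolding same_def by blast
  then show "\<eta> P (sat_InteriorPoint Q)"
    using P assms unfolding sat_InteriorPoint_iff Point_iff Concent_iff concentric_def cap_iff
    by blast
qed

lemma InteriorG_Region_iff:
  assumes "\<eta> Q Region"
  shows "\<eta> P (InteriorG Q) \<longleftrightarrow> \<eta> P Q"
  using klass_cong[OF sat_InteriorPoint_eq_ball_part[OF assms]]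
    eta_klass_iff[OF Region_klass_balls[OF assms]] InteriorG_iff by blast

lemma boundary_cong:
  assumes "\<And>P. \<eta> P A \<longleftrightarrow> \<eta> P B"
  shows "\<eta> P (boundary A) \<longleftrightarrow> \<eta> P (boundary B)"
  unfolding boundary_iff individual_cong[OF assms] pt_cong[OF assms] ext_cong[OF assms] ..

lemma complG_cong:
  assumes "\<And>P. \<eta> P A \<longleftrightarrow> \<eta> P B"
  shows "\<eta> P (complG A) \<longleftrightarrow> \<eta> P (complG B)"
proof -
  have "\<eta> P (cap (pt Gspace) (ext A)) \<longleftrightarrow> \<eta> P (cap (pt Gspace) (ext B))" for P
    unfolding cap_iff ext_cong[OF assms] ..
  then show ?thesis
    unfolding complG_iff individual_cong[OF assms] using klass_cong by blast
qed

lemma Tcompl_cong: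
  assumes "\<And>P. \<eta> P A \<longleftrightarrow> \<eta> P B"
  shows "\<eta> P (Tcompl A) \<longleftrightarrow> \<eta> P (Tcompl B)"
  unfolding Tcompl_iff cup_iff boundary_cong[OF assms] complG_cong[OF assms] ..

text \<open>This allows the interior of \<open>complG Q\<close> to be computed on an individual
  coextensive with \<open>complG Q\<close>.\<close>

lemma InteriorG_cong:
  assumes A: "\<eta> A Region" and AB: "\<And>P. \<eta> P A \<longleftrightarrow> \<eta> P B"
  shows "\<eta> P (InteriorG A) \<longleftrightarrow> \<eta> P (InteriorG B)"
  using InteriorG_Region_iff A individual_cong[OF AB] AB by metis

text \<open>Space is not inside \<open>Q\<close>, so supplementation yields something exterior to
  \<open>Q\<close>, and a nonempty name has a class.\<close>

lemma complG_exists: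
  assumes Q: "\<eta> Q (pt Gspace)" and neq: "\<not> same Q Gspace"
  obtains R where "\<eta> R (klass (cap (pt Gspace) (ext Q)))"
proof -
  have "\<not> \<eta> Gspace (pt Q)" using Q neq pt_antisym by blast
  then obtain D where "\<eta> D (cap (pt Gspace) (ext Q))"
    using exterior_part_exists Q Gspace_individual eta_individual cap_iff by metis
  then show ?thesis using klass_exists that by blast
qed

end

section \<open>Tarski's postulate and the closure\<close>

context tarski_solid_geometry
begin

text \<open>A part of space overlaps some ball, and the postulate applies to the common
  part.\<close>

lemma part_Gspace_contains_ball:
  assumes "\<eta> A (pt Gspace)"
  shows "\<exists>C. \<eta> C balls \<and> \<eta> C (pt A)"
proof -
  obtain B D where "\<eta> B balls" "\<eta> D (pt B)" "\<eta> D (pt A)"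
    using Gspace_klass assms unfolding klass_iff by blast
  then show ?thesis using part_of_ball pt_trans by blast
qed

lemma part_Gspace_Region:
  assumes A: "\<eta> A (pt Gspace)"
  shows "\<eta> A Region"
proof -
  have "\<exists>C D. \<eta> C (cap balls (pt A)) \<and> \<eta> D (pt C) \<and> \<eta> D (pt B)" if B: "\<eta> B (pt A)" for B
  proof -
    obtain C where "\<eta> C balls" "\<eta> C (pt B)"
      using part_Gspace_contains_ball A B pt_trans by blast
    \<comment> \<open>The ball inside \<open>B\<close> serves as both witnesses, being a part of
      itself.\<close>
    then show ?thesis using B pt_trans pt_refl eta_individual cap_iff by meson
  qed
  then have "\<eta> A (klass (cap balls (pt A)))"
    using A eta_individual cap_iff unfolding klass_iff by blast
  then show ?thesis
    using A eta_individual cap_iff unfolding Region_iff sub_name_def by blast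
qed

lemma closureG_iff_InteriorG_or_boundary:
  assumes Q: "\<eta> Q Region" and neq: "\<not> same Q Gspace"
  shows "\<eta> P (closureG Q) \<longleftrightarrow> \<eta> P (cup (InteriorG Q) (boundary Q))"
proof -
  have QG: "\<eta> Q (pt Gspace)" using Q Region_part_Gspace by blast
  obtain R where R: "\<eta> R (klass (cap (pt Gspace) (ext Q)))"
    using complG_exists QG neq by blast
  have RG: "\<eta> R (pt Gspace)" using complement_part[OF QG R] .
  have RReg: "\<eta> R Region" using RG part_Gspace_Region by blast
  have compl_Q: "\<eta> P R \<longleftrightarrow> \<eta> P (complG Q)" for P
    using QG eta_klass_iff[OF R] complG_iff by blast
  have int_compl_Q: "\<eta> P (InteriorG (complG Q)) \<longleftrightarrow> \<eta> P R" for P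
    using InteriorG_cong[OF RReg compl_Q] InteriorG_Region_iff[OF RReg] by blast
  have compl_R: "\<eta> P (complG R) \<longleftrightarrow> \<eta> P Q" for P
    using RG eta_klass_iff[OF complement_complement[OF QG R]] complG_iff by blast
  \<comment> \<open>Passing to the complement only swaps the two negated conditions on each ball
    \<open>Y\<close>, which is a part of space.\<close>
  have boundary_R: "\<eta> P (boundary R) \<longleftrightarrow> \<eta> P (boundary Q)" for P
    using Q RReg part_complement_iff[OF QG R] exterior_complement_iff[OF QG R] ball_part_Gspace
    unfolding boundary_iff by blast
  \<comment> \<open>The region condition in \<open>closureG\<close> is automatic here:
    \<open>P\<close> is the same individual as \<open>Q\<close> or is a ball.\<close>
  have Region: "\<eta> P Region" if "\<eta> P Q \<or> \<eta> P (boundary Q)"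
    using that Q eta_trans ball_Region boundary_iff by blast
  have "\<eta> P (closureG Q) \<longleftrightarrow> \<eta> P Region \<and> (\<eta> P Q \<or> \<eta> P (boundary Q))"
    using Q Tcompl_cong[OF int_compl_Q] compl_R boundary_R
    by (simp add: closureG_iff Tcompl_iff[of _ R] cup_iff)
  then show ?thesis
    unfolding cup_iff InteriorG_Region_iff[OF Q] using Region by blast
qed

end

theorem theorem7:
  fixes \<eta> :: "'n \<Rightarrow> 'n \<Rightarrow> bool"
  assumes "tarski_solid_geometry \<eta> cup cap pt klass ext balls Gspace Concent Point Region
             sat_InteriorPoint InteriorG boundary complG Tcompl closureG"
    and "\<eta> Q Region"
    and "\<not> ontology.same \<eta> Q Gspace"
  shows "\<eta> P (closureG Q) \<longleftrightarrow> \<eta> P (cup (InteriorG Q) (boundary Q))"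
  using tarski_solid_geometry.closureG_iff_InteriorG_or_boundary[OF assms] .

end
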